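(* Let $G$ be a group. Let $a,b\in G$ be elements which commute and let $G\curvearrowright X$, $G\curvearrowright Y$ be two actions on hyperbolic spaces such that (i) $a$ acts loxodromically and $b$ acts elliptically in the action $G\curvearrowright X$, and (ii) $b$ acts loxodromically in the action $G\curvearrowright Y$. Then there does not exist an action $G\curvearrowright Z$ with $Z$ hyperbolic such that $G\curvearrowright X \preceq G\curvearrowright Z$ and $G\curvearrowright Y\preceq G\curvearrowright Z$.
   Context: All actions on metric spaces are by isometries, and "hyperbolic" means geodesic and Gromov hyperbolic. A map $f\colon X\to Y$ is coarsely Lipschitz if there is $C>0$ with $d_Y(f(x),f(y))\le C d_X(x,y)+C$ for all $x,y\in X$. If $G$ acts on $X$ and $Y$, $f$ is coarsely $G$-equivariant if for every $x\in X$, $\sup_{g\in G} d_Y(f(gx),gf(x))<\infty$. Write $G\curvearrowright X\preceq G\curvearrowright Y$ if there is a coarsely $G$-equivariant coarsely Lipschitz map $Y\to X$. An element $g\in G$ acts elliptically on $X$ if it has bounded orbits, and loxodromically if the map $\mathbb{Z}\to X$, $n\mapsto g^nx_0$ is a quasi-isometric embedding for some (equivalently, any) $x_0\in X$. *)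

theory Defs
  imports "HOL-Analysis.Analysis" "HOL-Algebra.Group_Action"
begin

section \<open>Hyperbolic spaces\<close>

text \<open>A geodesic is parametrised by arc length, on the interval from \<open>0\<close> to the distance
  of its endpoints.\<close>

definition geodesic_metric :: "'a metric \<Rightarrow> bool" where
  "geodesic_metric X \<longleftrightarrow>
     (\<forall>x\<in>mspace X. \<forall>y\<in>mspace X. \<exists>\<gamma>::real \<Rightarrow> 'a.
        \<gamma> \<in> {0..mdist X x y} \<rightarrow> mspace X \<and> \<gamma> 0 = x \<and> \<gamma> (mdist X x y) = y \<and>
        (\<forall>s\<in>{0..mdist X x y}. \<forall>t\<in>{0..mdist X x y}. mdist X (\<gamma> s) (\<gamma> t) = \<bar>s - t\<bar>))"

definition gromov_product :: "'a metric \<Rightarrow> 'a \<Rightarrow> 'a \<Rightarrow> 'a \<Rightarrow> real" where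
  "gromov_product X w x y = (mdist X x w + mdist X y w - mdist X x y) / 2"

definition gromov_hyperbolic :: "'a metric \<Rightarrow> bool" where
  "gromov_hyperbolic X \<longleftrightarrow>
     (\<exists>\<delta>\<ge>0. \<forall>w\<in>mspace X. \<forall>x\<in>mspace X. \<forall>y\<in>mspace X. \<forall>z\<in>mspace X.
        gromov_product X w x z \<ge> min (gromov_product X w x y) (gromov_product X w y z) - \<delta>)"

text \<open>Spaces are non-empty by convention. Without it, the empty space would
  dominate every action, the empty map being coarsely Lipschitz and coarsely equivariant.\<close>

definition hyperbolic_space :: "'a metric \<Rightarrow> bool" where
  "hyperbolic_space X \<longleftrightarrow> mspace X \<noteq> {} \<and> geodesic_metric X \<and> gromov_hyperbolic X"


section \<open>Actions by isometries\<close>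

definition isometric_action ::
    "('g, 'k) monoid_scheme \<Rightarrow> 'a metric \<Rightarrow> ('g \<Rightarrow> 'a \<Rightarrow> 'a) \<Rightarrow> bool" where
  "isometric_action G X \<phi> \<longleftrightarrow> group_action G (mspace X) \<phi> \<and>
     (\<forall>g\<in>carrier G. \<forall>x\<in>mspace X. \<forall>y\<in>mspace X. mdist X (\<phi> g x) (\<phi> g y) = mdist X x y)"

definition elliptic ::
    "('g, 'k) monoid_scheme \<Rightarrow> 'a metric \<Rightarrow> ('g \<Rightarrow> 'a \<Rightarrow> 'a) \<Rightarrow> 'g \<Rightarrow> bool" where
  "elliptic G X \<phi> g \<longleftrightarrow> (\<forall>x\<in>mspace X.
     Metric_space.mbounded (mspace X) (mdist X) (range (\<lambda>n::int. \<phi> (g [^]\<^bsub>G\<^esub> n) x)))"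

definition quasi_isometric_embedding :: "'a metric \<Rightarrow> 'b metric \<Rightarrow> ('a \<Rightarrow> 'b) \<Rightarrow> bool" where
  "quasi_isometric_embedding X Y f \<longleftrightarrow> f \<in> mspace X \<rightarrow> mspace Y \<and>
     (\<exists>K\<ge>1. \<exists>C\<ge>0. \<forall>x\<in>mspace X. \<forall>y\<in>mspace X.
        mdist X x y / K - C \<le> mdist Y (f x) (f y) \<and> mdist Y (f x) (f y) \<le> K * mdist X x y + C)"

definition int_metric :: "int metric" where
  "int_metric = metric (UNIV, \<lambda>m n. \<bar>real_of_int m - real_of_int n\<bar>)"

lemma Metric_space_int: "Metric_space UNIV (\<lambda>m n. \<bar>real_of_int m - real_of_int n\<bar>)"
  by unfold_locales auto

lemma mspace_int_metric [simp]: "mspace int_metric = UNIV"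
  and mdist_int_metric [simp]: "mdist int_metric m n = \<bar>real_of_int m - real_of_int n\<bar>"
  by (simp_all add: int_metric_def Metric_space.mspace_metric Metric_space.mdist_metric
      Metric_space_int)

definition loxodromic ::
    "('g, 'k) monoid_scheme \<Rightarrow> 'a metric \<Rightarrow> ('g \<Rightarrow> 'a \<Rightarrow> 'a) \<Rightarrow> 'g \<Rightarrow> bool" where
  "loxodromic G X \<phi> g \<longleftrightarrow> (\<exists>x\<in>mspace X.
     quasi_isometric_embedding int_metric X (\<lambda>n. \<phi> (g [^]\<^bsub>G\<^esub> n) x))"


section \<open>Comparing actions\<close>

definition coarsely_Lipschitz :: "'a metric \<Rightarrow> 'b metric \<Rightarrow> ('a \<Rightarrow> 'b) \<Rightarrow> bool" where
  "coarsely_Lipschitz X Y f \<longleftrightarrow> f \<in> mspace X \<rightarrow> mspace Y \<and>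
     (\<exists>C>0. \<forall>x\<in>mspace X. \<forall>y\<in>mspace X. mdist Y (f x) (f y) \<le> C * mdist X x y + C)"

definition coarsely_equivariant ::
    "('g, 'k) monoid_scheme \<Rightarrow> 'a metric \<Rightarrow> ('g \<Rightarrow> 'a \<Rightarrow> 'a) \<Rightarrow>
     'b metric \<Rightarrow> ('g \<Rightarrow> 'b \<Rightarrow> 'b) \<Rightarrow> ('a \<Rightarrow> 'b) \<Rightarrow> bool" where
  "coarsely_equivariant G X \<phi> Y \<psi> f \<longleftrightarrow>
     (\<forall>x\<in>mspace X. bdd_above ((\<lambda>g. mdist Y (f (\<phi> g x)) (\<psi> g (f x))) ` carrier G))"

text \<open>The smaller action comes first, so the map goes from the second space to the first.\<close>

definition action_le ::
    "('g, 'k) monoid_scheme \<Rightarrow> 'a metric \<Rightarrow> ('g \<Rightarrow> 'a \<Rightarrow> 'a) \<Rightarrow>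
     'b metric \<Rightarrow> ('g \<Rightarrow> 'b \<Rightarrow> 'b) \<Rightarrow> bool" where
  "action_le G X \<phi> Y \<psi> \<longleftrightarrow>
     (\<exists>f. coarsely_Lipschitz Y X f \<and> coarsely_equivariant G Y \<psi> X \<phi> f)"

end

theory Submission
  imports Defs "HOL-Real_Asymp.Real_Asymp"
begin

text \<open>Write \<open>\<bar>g\<bar>\<close> for the displacement by \<open>g\<close> of a base point of \<open>Z\<close>. For commuting \<open>g\<close> and \<open>h\<close>
  the four-point condition, applied to the orbit points of \<open>1\<close>, \<open>g\<close>, \<open>h\<close>, \<open>gh\<close>, says that
  \<open>\<bar>gh\<bar> + \<bar>gh\<^sup>-\<^sup>1\<bar> \<le> 2 max \<bar>g\<bar> \<bar>h\<bar>\<close> up to an additive constant. Passing to stable lengths removes the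
  constant and gives a seminorm \<open>N\<close> on the group generated by \<open>a\<close> and \<open>b\<close>. If \<open>Z\<close> dominated both
  \<open>X\<close> and \<open>Y\<close>, then \<open>N (a\<^sup>m b\<^sup>n)\<close> would grow linearly in \<open>m\<close>, uniformly in \<open>n\<close>, and \<open>N (b\<^sup>n)\<close> would
  grow linearly in \<open>n\<close>. The displayed inequality excludes such a seminorm on \<open>\<int>\<^sup>2\<close>: it fails at
  two vectors of almost equal length whose sum and difference also have almost that length.\<close>

lemma stable_length_exists:
  fixes L :: "int \<Rightarrow> int \<Rightarrow> real"
  assumes nonneg: "\<And>m n. 0 \<le> L m n"
    and subadd: "\<And>m n m' n'. L (m + m') (n + n') \<le> L m n + L m' n'"
    and four: "\<And>m n m' n'. L (m + m') (n + n') + L (m - m') (n - n')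
      \<le> 2 * max (L m n) (L m' n') + D"
  obtains N where
    "\<And>m n. (\<lambda>i. L (2 ^ i * m) (2 ^ i * n) / 2 ^ i) \<longlonglongrightarrow> N m n"
    "\<And>m n. 0 \<le> N m n"
    "\<And>m n m' n'. N (m + m') (n + n') \<le> N m n + N m' n'"
    "\<And>m n m' n'. N (m + m') (n + n') + N (m - m') (n - n') \<le> 2 * max (N m n) (N m' n')"
    "\<And>m n. N (2 * m) (2 * n) = 2 * N m n"
proof -
  define s where "s m n i = L (2 ^ i * m) (2 ^ i * n) / 2 ^ i" for m n and i :: nat
  define N where "N m n = lim (s m n)" for m n
  have s_nonneg: "0 \<le> s m n i" for m n i
    by (simp add: s_def nonneg)
  \<comment> \<open>Along powers of two, subadditivity applied to two equal vectors already makes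
    the quotients decrease, so the limit exists by monotonicity. Shifting the index later gives
    exact doubling for \<open>N\<close>.\<close>
  have dec: "decseq (s m n)" for m n
  proof (rule decseq_SucI)
    fix i
    have "L (2 ^ Suc i * m) (2 ^ Suc i * n) \<le> 2 * L (2 ^ i * m) (2 ^ i * n)"
      using subadd[of "2 ^ i * m" "2 ^ i * m" "2 ^ i * n" "2 ^ i * n"]
      by (simp add: algebra_simps)
    then show "s m n (Suc i) \<le> s m n i"
      by (simp add: s_def field_simps)
  qed
  have lim: "s m n \<longlonglongrightarrow> N m n" for m n
  proof -
    obtain l where "s m n \<longlonglongrightarrow> l"
      using decseq_convergent[OF dec, of 0 m n] s_nonneg by metis
    then show ?thesis by (simp add: N_def limI)
  qed
  have zero: "(\<lambda>i. D / 2 ^ i) \<longlonglongrightarrow> 0"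
    by real_asymp
  show thesis
  proof (rule that[of N])
    show "(\<lambda>i. L (2 ^ i * m) (2 ^ i * n) / 2 ^ i) \<longlonglongrightarrow> N m n" for m n
      using lim[of m n] by (simp add: s_def[abs_def])
    show "0 \<le> N m n" for m n
      by (rule LIMSEQ_le_const[OF lim]) (simp add: s_nonneg)
    show "N (m + m') (n + n') \<le> N m n + N m' n'" for m n m' n'
    proof (rule LIMSEQ_le[OF lim tendsto_add[OF lim lim]], intro exI allI impI)
      fix i
      show "s (m + m') (n + n') i \<le> s m n i + s m' n' i"
        using subadd[of "2 ^ i * m" "2 ^ i * m'" "2 ^ i * n" "2 ^ i * n'"]
        by (simp add: s_def field_simps)
    qed
    show "N (m + m') (n + n') + N (m - m') (n - n') \<le> 2 * max (N m n) (N m' n')" for m n m' n'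
    proof -
      have "N (m + m') (n + n') + N (m - m') (n - n') \<le> 2 * max (N m n) (N m' n') + 0"
      proof (rule LIMSEQ_le)
        show "(\<lambda>i. s (m + m') (n + n') i + s (m - m') (n - n') i)
            \<longlonglongrightarrow> N (m + m') (n + n') + N (m - m') (n - n')"
          by (intro tendsto_add lim)
        show "(\<lambda>i. 2 * max (s m n i) (s m' n' i) + D / 2 ^ i)
            \<longlonglongrightarrow> 2 * max (N m n) (N m' n') + 0"
          by (intro tendsto_intros lim zero)
        have "s (m + m') (n + n') i + s (m - m') (n - n') i
            \<le> 2 * max (s m n i) (s m' n' i) + D / 2 ^ i" for i
        proof -
          have "s (m + m') (n + n') i + s (m - m') (n - n') i
              = (L (2 ^ i * m + 2 ^ i * m') (2 ^ i * n + 2 ^ i * n')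
                + L (2 ^ i * m - 2 ^ i * m') (2 ^ i * n - 2 ^ i * n')) / 2 ^ i"
            by (simp add: s_def add_divide_distrib algebra_simps)
          also have "\<dots> \<le> (2 * max (L (2 ^ i * m) (2 ^ i * n)) (L (2 ^ i * m') (2 ^ i * n')) + D)
              / 2 ^ i"
            by (rule divide_right_mono[OF four]) simp
          also have "\<dots> = 2 * max (s m n i) (s m' n' i) + D / 2 ^ i"
            by (simp add: s_def add_divide_distrib max_divide_distrib_right
                flip: times_divide_eq_right)
          finally show ?thesis .
        qed
        then show "\<exists>k. \<forall>i\<ge>k. s (m + m') (n + n') i + s (m - m') (n - n') i
            \<le> 2 * max (s m n i) (s m' n' i) + D / 2 ^ i"
          by blast
      qed
      then show ?thesis by simp
    qed
    show "N (2 * m) (2 * n) = 2 * N m n" for m n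
    proof (rule LIMSEQ_unique[OF lim])
      have "s (2 * m) (2 * n) = (\<lambda>i. 2 * s m n (Suc i))"
        by (auto simp: s_def fun_eq_iff algebra_simps)
      then show "s (2 * m) (2 * n) \<longlonglongrightarrow> 2 * N m n"
        using LIMSEQ_Suc[OF lim[of m n]] by (auto intro: tendsto_intros)
    qed
  qed
qed

text \<open>On each column with first coordinate \<open>k\<close>, \<open>N\<close> is bounded below
  by \<open>c * k\<close>, while on the column of 0 it is unbounded but grows by at most
  \<open>B\<close> per step. A near-minimum of a far column is therefore matched in length by a
  vector (0, j), up to \<open>B\<close>. Two uses of the four-point inequality for \<open>N\<close>
  on this pair bound their common length by a constant independent of \<open>k\<close>.\<close>

lemma no_hyperbolic_length_on_int_pairs:
  fixes L :: "int \<Rightarrow> int \<Rightarrow> real"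
  assumes nonneg: "\<And>m n. 0 \<le> L m n"
    and subadd: "\<And>m n m' n'. L (m + m') (n + n') \<le> L m n + L m' n'"
    and four: "\<And>m n m' n'. L (m + m') (n + n') + L (m - m') (n - n')
      \<le> 2 * max (L m n) (L m' n') + D"
    and c: "c > 0" "\<And>m n. c * \<bar>of_int m\<bar> - C \<le> L m n"
    and e: "e > 0" "\<And>n. e * \<bar>of_int n\<bar> - E \<le> L 0 n"
  shows False
proof -
  obtain N where lim: "\<And>m n. (\<lambda>i. L (2 ^ i * m) (2 ^ i * n) / 2 ^ i) \<longlonglongrightarrow> N m n"
    and N_nonneg: "\<And>m n. 0 \<le> N m n"
    and N_subadd: "\<And>m n m' n'. N (m + m') (n + n') \<le> N m n + N m' n'"
    and N_four: "\<And>m n m' n'. N (m + m') (n + n') + N (m - m') (n - n')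
      \<le> 2 * max (N m n) (N m' n')"
    and N_double: "\<And>m n. N (2 * m) (2 * n) = 2 * N m n"
    by (rule stable_length_exists[of L D, OF nonneg subadd four]) blast
  \<comment> \<open>Rescaling by powers of two turns the additive error \<open>R\<close> into
    \<open>R / 2 ^ i\<close>, which vanishes in the limit.\<close>
  have N_ge: "r * \<bar>of_int k\<bar> \<le> N m n"
    if "\<And>i. r * \<bar>of_int (2 ^ i * k)\<bar> - R \<le> L (2 ^ i * m) (2 ^ i * n)" for r R k m n
  proof -
    have conv: "(\<lambda>i. r * \<bar>of_int k\<bar> - R / 2 ^ i) \<longlonglongrightarrow> r * \<bar>of_int k\<bar>"
      by real_asymp
    show ?thesis
    proof (rule LIMSEQ_le[OF conv lim], intro exI allI impI)
      fix i
      show "r * \<bar>of_int k\<bar> - R / 2 ^ i \<le> L (2 ^ i * m) (2 ^ i * n) / 2 ^ i"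
        using divide_right_mono[OF that[of i], of "2 ^ i"]
        by (simp add: diff_divide_distrib abs_mult mult.commute mult.left_commute)
    qed
  qed
  have N_c: "c * \<bar>of_int m\<bar> \<le> N m n" for m n
    by (rule N_ge) (rule c)
  have N_e: "e * \<bar>of_int n\<bar> \<le> N 0 n" for n
  proof (rule N_ge)
    show "e * \<bar>of_int (2 ^ i * n)\<bar> - E \<le> L (2 ^ i * 0) (2 ^ i * n)" for i
      using e(2)[of "2 ^ i * n"] by simp
  qed

  define B where "B = N 0 1"
  \<comment> \<open>The bound 2B + 1 is what the two four-point estimates below yield for
    \<open>\<mu>\<close>; this \<open>k\<close> makes every value on its column exceed it.\<close>
  obtain k :: nat where k: "2 * B + 1 < c * k"
    using reals_Archimedean3[OF c(1)] by (metis mult.commute)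
  have bdd: "bdd_below (range (N (int k)))"
    using N_nonneg by (auto intro!: bdd_belowI[of _ 0])
  \<comment> \<open>The infimum need not be attained, so a minimiser up to 1 is taken.\<close>
  obtain n where n: "N k n < Inf (range (N k)) + 1"
    using cInf_lessD[of "range (N k)" "Inf (range (N k)) + 1"] by auto
  define \<mu> where "\<mu> = N k n"
  have min: "\<mu> - 1 \<le> N k n'" for n'
    using cInf_lower[OF _ bdd, of "N k n'"] n by (simp add: \<mu>_def)
  obtain i :: nat where i: "\<mu> < e * i"
    using reals_Archimedean3[OF e(1)] by (metis mult.commute)
  then have ex: "\<exists>j::nat. \<mu> \<le> N 0 j"
    using N_e[of "int i"] by (intro exI[of _ i]) simp
  \<comment> \<open>At the first crossing of the level \<open>\<mu>\<close>, the overshoot is at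
    most one increment \<open>B\<close>.\<close>
  define j where "j = (LEAST j::nat. \<mu> \<le> N 0 j)"
  have j_ge: "\<mu> \<le> N 0 j"
    unfolding j_def using LeastI_ex[OF ex] .
  have N0: "N 0 0 = 0"
    using N_double[of 0 0] by simp
  have j_le: "N 0 j \<le> \<mu> + B"
  proof (cases j)
    case 0
    then show ?thesis
      using N0 N_nonneg by (simp add: \<mu>_def B_def)
  next
    case (Suc j')
    then have "N 0 j' < \<mu>"
      using not_less_Least[of j' "\<lambda>j. \<mu> \<le> N 0 (int j)"] by (simp add: j_def)
    then show ?thesis
      using N_subadd[of 0 0 j' 1] Suc by (simp add: B_def add.commute)
  qed
  have B0: "0 \<le> B"
    by (simp add: B_def N_nonneg)
  \<comment> \<open>First use, for (k, n) and (0, j): the sum and difference stay on column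
    \<open>k\<close>, so each is at least \<open>\<mu> - 1\<close>, and hence neither can exceed
    \<open>\<mu>\<close> by more than 2B + 1.\<close>
  have "N k (n + j) + N k (n - j) \<le> 2 * \<mu> + 2 * B"
    using N_four[of k 0 n j] j_le B0 by (simp add: \<mu>_def[symmetric])
  then have "N k (n + j) \<le> \<mu> + 2 * B + 1" "N k (n - j) \<le> \<mu> + 2 * B + 1"
    using min[of "n + j"] min[of "n - j"] by linarith+
  \<comment> \<open>Second use, for that sum and difference: their own sum and difference are the
    doubles of (k, n) and (0, j). Doubling and cancelling \<open>\<mu>\<close> leaves
    \<open>N 0 j \<le> 2 * B + 1\<close>.\<close>
  moreover have "N (2 * int k) (2 * n) + N (2 * 0) (2 * int j)
      \<le> 2 * max (N k (n + j)) (N k (n - j))"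
    using N_four[of k k "n + j" "n - j"] by simp
  ultimately have "\<mu> \<le> 2 * B + 1"
    using j_ge unfolding N_double by (simp add: \<mu>_def)
  then show False
    using N_c[of "int k" n] k by (simp add: \<mu>_def)
qed

section \<open>Hyperbolicity and displacements of orbit points\<close>

lemma gromov_hyperbolic_four_point:
  assumes "gromov_hyperbolic Z"
  obtains D where "\<And>w x y z. \<lbrakk>w \<in> mspace Z; x \<in> mspace Z; y \<in> mspace Z; z \<in> mspace Z\<rbrakk> \<Longrightarrow>
    mdist Z w y + mdist Z x z \<le>
      max (mdist Z w x + mdist Z y z) (mdist Z w z + mdist Z x y) + D"
proof -
  obtain \<delta> where \<delta>: "\<And>w x y z. \<lbrakk>w \<in> mspace Z; x \<in> mspace Z; y \<in> mspace Z; z \<in> mspace Z\<rbrakk> \<Longrightarrow>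
    min (gromov_product Z w x y) (gromov_product Z w y z) - \<delta> \<le> gromov_product Z w x z"
    using assms unfolding gromov_hyperbolic_def by meson
  \<comment> \<open>Double the Gromov product inequality and subtract it from the sum of the
    distances from \<open>w\<close> to \<open>x\<close>, \<open>y\<close>, \<open>z\<close>: the
    minimum becomes a maximum and the error becomes 2\<delta>.\<close>
  show thesis
  proof (rule that[of "2 * \<delta>"])
    fix w x y z
    assume "w \<in> mspace Z" "x \<in> mspace Z" "y \<in> mspace Z" "z \<in> mspace Z"
    from \<delta>[OF this] show "mdist Z w y + mdist Z x z \<le>
        max (mdist Z w x + mdist Z y z) (mdist Z w z + mdist Z x y) + 2 * \<delta>"
      by (simp add: gromov_product_def mdist_commute[of Z _ w] min_def max_def field_simps
          split: if_splits)
  qed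
qed

lemma
  assumes "isometric_action G X \<phi>"
  shows isometric_action_closed:
      "\<lbrakk>g \<in> carrier G; x \<in> mspace X\<rbrakk> \<Longrightarrow> \<phi> g x \<in> mspace X"
    and isometric_action_mult:
      "\<lbrakk>g \<in> carrier G; h \<in> carrier G; x \<in> mspace X\<rbrakk> \<Longrightarrow> \<phi> (g \<otimes>\<^bsub>G\<^esub> h) x = \<phi> g (\<phi> h x)"
    and isometric_action_dist:
      "\<lbrakk>g \<in> carrier G; x \<in> mspace X; y \<in> mspace X\<rbrakk> \<Longrightarrow>
        mdist X (\<phi> g x) (\<phi> g y) = mdist X x y"
    and isometric_action_one:
      "x \<in> mspace X \<Longrightarrow> \<phi> \<one>\<^bsub>G\<^esub> x = x"
proof -
  interpret group_action G "mspace X" \<phi>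
    using assms by (simp add: isometric_action_def)
  show "\<lbrakk>g \<in> carrier G; x \<in> mspace X\<rbrakk> \<Longrightarrow> \<phi> g x \<in> mspace X"
    by (simp add: element_image)
  show "\<lbrakk>g \<in> carrier G; h \<in> carrier G; x \<in> mspace X\<rbrakk> \<Longrightarrow> \<phi> (g \<otimes>\<^bsub>G\<^esub> h) x = \<phi> g (\<phi> h x)"
    by (simp add: composition_rule)
  show "\<lbrakk>g \<in> carrier G; x \<in> mspace X; y \<in> mspace X\<rbrakk> \<Longrightarrow>
      mdist X (\<phi> g x) (\<phi> g y) = mdist X x y"
    using assms by (simp add: isometric_action_def)
  show "x \<in> mspace X \<Longrightarrow> \<phi> \<one>\<^bsub>G\<^esub> x = x"
    using id_eq_one by (metis restrict_apply')
qed

text \<open>Loxodromicity supplies one base point, but the comparison maps dictate another.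
  Isometries move both points rigidly, so the change costs twice their distance.\<close>

lemma loxodromic_displacement:
  assumes "group G" and act: "isometric_action G X \<phi>" and "loxodromic G X \<phi> g"
    and g: "g \<in> carrier G" and x: "x \<in> mspace X"
  obtains c C where "c > 0"
    "\<And>n::int. c * \<bar>of_int n\<bar> - C \<le> mdist X x (\<phi> (g [^]\<^bsub>G\<^esub> n) x)"
proof -
  interpret group G by fact
  obtain y K C where y: "y \<in> mspace X" and K: "K \<ge> 1"
    and qi: "\<And>m n::int. \<bar>of_int m - of_int n\<bar> / K - C
      \<le> mdist X (\<phi> (g [^]\<^bsub>G\<^esub> m) y) (\<phi> (g [^]\<^bsub>G\<^esub> n) y)"
    using assms(3) unfolding loxodromic_def quasi_isometric_embedding_def
    by (metis UNIV_I mdist_int_metric mspace_int_metric)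
  show thesis
  proof (rule that[of "1 / K" "C + 2 * mdist X x y"])
    show "1 / K > 0" using K by simp
    fix n :: int
    define h where "h = g [^]\<^bsub>G\<^esub> n"
    have h: "h \<in> carrier G" by (simp add: h_def g)
    note [simp] = isometric_action_closed[OF act] h x y
    have "mdist X y (\<phi> h y) \<le> mdist X y x + mdist X x (\<phi> h x) + mdist X (\<phi> h x) (\<phi> h y)"
      using mdist_triangle[of y X x "\<phi> h y"] mdist_triangle[of x X "\<phi> h x" "\<phi> h y"] by simp
    then show "1 / K * \<bar>of_int n\<bar> - (C + 2 * mdist X x y) \<le> mdist X x (\<phi> (g [^]\<^bsub>G\<^esub> n) x)"
      using qi[of 0 n]
      by (simp add: h_def[symmetric] isometric_action_dist[OF act] isometric_action_one[OF act]
          mdist_commute[of X y x])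
  qed
qed

lemma elliptic_displacement:
  assumes "group G" and act: "isometric_action G X \<phi>" and "elliptic G X \<phi> g"
    and g: "g \<in> carrier G" and x: "x \<in> mspace X"
  obtains M where "\<And>n::int. mdist X x (\<phi> (g [^]\<^bsub>G\<^esub> n) x) \<le> M"
proof -
  interpret group G by fact
  interpret Metric_space "mspace X" "mdist X" by simp
  have "mbounded (range (\<lambda>n::int. \<phi> (g [^]\<^bsub>G\<^esub> n) x))"
    using assms(3) x by (simp add: elliptic_def)
  then obtain M where
    M: "\<And>(m::int) (n::int). mdist X (\<phi> (g [^]\<^bsub>G\<^esub> m) x) (\<phi> (g [^]\<^bsub>G\<^esub> n) x) \<le> M"
    unfolding mbounded_alt by auto
  show thesis
  proof (rule that)
    show "mdist X x (\<phi> (g [^]\<^bsub>G\<^esub> n) x) \<le> M" for n :: int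
      using M[of 0 n] by (simp add: isometric_action_one[OF act] x)
  qed
qed

text \<open>The point \<open>x\<close> is the image of \<open>z\<close>. The Lipschitz bound
  controls its distance to the image of \<open>\<zeta> g z\<close>, and coarse equivariance replaces
  that image by \<open>\<phi> g x\<close> at a cost independent of \<open>g\<close>. Lower bounds on
  displacement in \<open>X\<close> thus pass to \<open>Z\<close>.\<close>

lemma action_le_displacement:
  assumes act: "isometric_action G X \<phi>" and "action_le G X \<phi> Z \<zeta>"
    and act': "isometric_action G Z \<zeta>" and z: "z \<in> mspace Z"
  obtains x C where "x \<in> mspace X" "C > 0"
    "\<And>g. g \<in> carrier G \<Longrightarrow> mdist X x (\<phi> g x) \<le> C * mdist Z z (\<zeta> g z) + C"
proof -
  obtain f C where f: "f \<in> mspace Z \<rightarrow> mspace X" and C: "C > 0"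
    and lip: "\<And>x y. \<lbrakk>x \<in> mspace Z; y \<in> mspace Z\<rbrakk> \<Longrightarrow> mdist X (f x) (f y) \<le> C * mdist Z x y + C"
    and eqv: "coarsely_equivariant G Z \<zeta> X \<phi> f"
    using assms(2) unfolding action_le_def coarsely_Lipschitz_def by blast
  obtain E where E: "\<And>g. g \<in> carrier G \<Longrightarrow> mdist X (f (\<zeta> g z)) (\<phi> g (f z)) \<le> E"
    using eqv z unfolding coarsely_equivariant_def bdd_above_def by blast
  note closed = isometric_action_closed[OF act] isometric_action_closed[OF act']
  have fz: "f z \<in> mspace X" using f z by blast
  show thesis
  proof (rule that[of "f z" "C + \<bar>E\<bar>"])
    show "f z \<in> mspace X" "C + \<bar>E\<bar> > 0" using fz C by auto
    fix g assume g: "g \<in> carrier G"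
    have "mdist X (f z) (\<phi> g (f z)) \<le> mdist X (f z) (f (\<zeta> g z)) + mdist X (f (\<zeta> g z)) (\<phi> g (f z))"
      using f z g closed by (intro mdist_triangle) auto
    also have "\<dots> \<le> C * mdist Z z (\<zeta> g z) + C + E"
      using lip[of z "\<zeta> g z"] E[OF g] z g closed by fastforce
    also have "\<dots> \<le> (C + \<bar>E\<bar>) * mdist Z z (\<zeta> g z) + (C + \<bar>E\<bar>)"
      using mult_nonneg_nonneg[OF abs_ge_zero[of E] mdist_nonneg[of Z z "\<zeta> g z"]] abs_ge_self[of E]
      unfolding distrib_right by linarith
    finally show "mdist X (f z) (\<phi> g (f z)) \<le> (C + \<bar>E\<bar>) * mdist Z z (\<zeta> g z) + (C + \<bar>E\<bar>)" .
  qed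
qed

lemma (in group) int_pow_comm:
  assumes "x \<otimes> y = y \<otimes> x" "x \<in> carrier G" "y \<in> carrier G"
  shows "x [^] (m::int) \<otimes> y [^] (n::int) = y [^] n \<otimes> x [^] m"
proof -
  have nat: "u [^] (k::nat) \<otimes> v = v \<otimes> u [^] k"
    if "u \<otimes> v = v \<otimes> u" "u \<in> carrier G" "v \<in> carrier G" for u v k
    using that by (induction k) (simp_all add: m_assoc, metis m_assoc nat_pow_closed)
  have int: "u [^] (k::int) \<otimes> v = v \<otimes> u [^] k"
    if uv: "u \<otimes> v = v \<otimes> u" "u \<in> carrier G" "v \<in> carrier G" for u v k
  proof (cases k rule: int_cases2)
    case (nonneg i)
    then show ?thesis using nat[OF uv] by (simp add: int_pow_int)
  next
    case (nonpos i)
    have "inv (u [^] i) \<otimes> v = inv (u [^] i) \<otimes> (v \<otimes> u [^] i) \<otimes> inv (u [^] i)"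
      using uv by (simp add: m_assoc)
    also have "\<dots> = v \<otimes> inv (u [^] i)"
      using uv nat[OF uv, of i, symmetric] by (simp add: m_assoc[symmetric])
    finally show ?thesis
      using nonpos uv by (simp add: int_pow_neg int_pow_int)
  qed
  \<comment> \<open>The inner use makes \<open>x\<close> commute with a power of \<open>y\<close>;
    the outer one then passes to powers of \<open>x\<close>.\<close>
  show ?thesis
    using int[of x "y [^] n" m] int[of y x n] assms by simp
qed

section \<open>The orbit of the subgroup generated by the commuting pair\<close>

theorem lemma1p4:
  fixes G :: "('g, 'k) monoid_scheme" (structure)
    and a b :: 'g
    and X :: "'x metric" and \<phi> :: "'g \<Rightarrow> 'x \<Rightarrow> 'x"
    and Y :: "'y metric" and \<psi> :: "'g \<Rightarrow> 'y \<Rightarrow> 'y"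
  assumes "group G"
    and "a \<in> carrier G" and "b \<in> carrier G" and "a \<otimes> b = b \<otimes> a"
    and "hyperbolic_space X" and "isometric_action G X \<phi>"
    and "hyperbolic_space Y" and "isometric_action G Y \<psi>"
    and "loxodromic G X \<phi> a" and "elliptic G X \<phi> b"
    and "loxodromic G Y \<psi> b"
  shows "\<not> (\<exists>(Z :: 'z metric) (\<zeta> :: 'g \<Rightarrow> 'z \<Rightarrow> 'z).
            hyperbolic_space Z \<and> isometric_action G Z \<zeta> \<and>
            action_le G X \<phi> Z \<zeta> \<and> action_le G Y \<psi> Z \<zeta>)"
proof safe
  fix Z :: "'z metric" and \<zeta>
  assume "hyperbolic_space Z" and actZ: "isometric_action G Z \<zeta>"
    and leX: "action_le G X \<phi> Z \<zeta>" and leY: "action_le G Y \<psi> Z \<zeta>"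
  interpret group G by fact
  note a = assms(2) and b = assms(3) and actX = assms(6) and actY = assms(8)
  obtain z where z: "z \<in> mspace Z" and hyp: "gromov_hyperbolic Z"
    using \<open>hyperbolic_space Z\<close> by (auto simp: hyperbolic_space_def)
  obtain D where D: "\<And>w x y z. \<lbrakk>w \<in> mspace Z; x \<in> mspace Z; y \<in> mspace Z; z \<in> mspace Z\<rbrakk> \<Longrightarrow>
      mdist Z w y + mdist Z x z \<le>
        max (mdist Z w x + mdist Z y z) (mdist Z w z + mdist Z x y) + D"
    by (rule gromov_hyperbolic_four_point[OF hyp]) blast
  define h where "h m n = a [^] m \<otimes> b [^] n" for m n :: int
  have h [simp]: "h m n \<in> carrier G" for m n
    by (simp add: h_def a b)
  have h_add: "h (m + m') (n + n') = h m n \<otimes> h m' n'" for m n m' n'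
  proof -
    have "h m n \<otimes> h m' n' = a [^] m \<otimes> (b [^] n \<otimes> a [^] m') \<otimes> b [^] n'"
      by (simp add: h_def a b m_assoc)
    also have "\<dots> = a [^] m \<otimes> (a [^] m' \<otimes> b [^] n) \<otimes> b [^] n'"
      by (simp add: int_pow_comm[OF assms(4) a b])
    also have "\<dots> = h (m + m') (n + n')"
      by (simp add: h_def a b m_assoc int_pow_mult)
    finally show ?thesis by simp
  qed
  define p where "p m n = \<zeta> (h m n) z" for m n
  define L where "L m n = mdist Z z (p m n)" for m n
  have p [simp]: "p m n \<in> mspace Z" for m n
    by (simp add: p_def isometric_action_closed[OF actZ] z)
  have p0: "p 0 0 = z"
    by (simp add: p_def h_def isometric_action_one[OF actZ] z)
  \<comment> \<open>Since \<open>h\<close> is additive, translating by an isometry makes orbit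
    distances depend only on the difference of indices.\<close>
  have dist_p: "mdist Z (p m n) (p m' n') = L (m' - m) (n' - n)" for m n m' n'
  proof -
    have "p m' n' = \<zeta> (h m n) (p (m' - m) (n' - n))"
      using h_add[of m "m' - m" n "n' - n"]
      by (simp add: p_def isometric_action_mult[OF actZ] z)
    then show ?thesis
      by (simp add: p_def[of m n] isometric_action_dist[OF actZ] z L_def)
  qed
  have L_minus: "L (- m) (- n) = L m n" for m n
    using dist_p[of m n 0 0] by (simp add: p0 L_def mdist_commute)
  have subadd: "L (m + m') (n + n') \<le> L m n + L m' n'" for m n m' n'
    using mdist_triangle[of z Z "p m n" "p (m + m') (n + n')"] z
    by (simp add: dist_p L_def[symmetric])
  \<comment> \<open>In this parallelogram of orbit points opposite sides have equal length, so the
    two side sums are \<open>2 * L m n\<close> and \<open>2 * L m' n'\<close>, while the diagonals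
    give the sum and the difference.\<close>
  have four: "L (m + m') (n + n') + L (m - m') (n - n') \<le> 2 * max (L m n) (L m' n') + D"
    for m n m' n'
    using D[of z "p m n" "p (m + m') (n + n')" "p m' n'"] z L_minus[of m n]
      L_minus[of "m - m'" "n - n'"]
    by (simp add: dist_p L_def[symmetric])

  obtain x C where x: "x \<in> mspace X" and C: "C > 0"
    and LX: "\<And>g. g \<in> carrier G \<Longrightarrow> mdist X x (\<phi> g x) \<le> C * mdist Z z (\<zeta> g z) + C"
    by (rule action_le_displacement[OF actX leX actZ z]) blast
  obtain y E where y: "y \<in> mspace Y" and E: "E > 0"
    and LY: "\<And>g. g \<in> carrier G \<Longrightarrow> mdist Y y (\<psi> g y) \<le> E * mdist Z z (\<zeta> g z) + E"
    by (rule action_le_displacement[OF actY leY actZ z]) blast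
  obtain c c' where c: "c > 0" "\<And>n::int. c * \<bar>of_int n\<bar> - c' \<le> mdist X x (\<phi> (a [^] n) x)"
    by (rule loxodromic_displacement[OF assms(1) actX assms(9) a x]) blast
  obtain e e' where e: "e > 0" "\<And>n::int. e * \<bar>of_int n\<bar> - e' \<le> mdist Y y (\<psi> (b [^] n) y)"
    by (rule loxodromic_displacement[OF assms(1) actY assms(11) b y]) blast
  obtain M where M: "\<And>n::int. mdist X x (\<phi> (b [^] n) x) \<le> M"
    by (rule elliptic_displacement[OF assms(1) actX assms(10) b x]) blast
  \<comment> \<open>Uniformity in \<open>n\<close> comes from ellipticity: after cancelling the
    common factor \<open>a [^] m\<close>, changing \<open>n\<close> moves the orbit point by at most
    \<open>M\<close>.\<close>
  have boundX: "c / C * \<bar>of_int m\<bar> - (c' + M + C) / C \<le> L m n" for m n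
  proof -
    note [simp] = isometric_action_closed[OF actX] isometric_action_dist[OF actX] x a b
    have "mdist X x (\<phi> (a [^] m) x)
        \<le> mdist X x (\<phi> (h m n) x) + mdist X (\<phi> (h m n) x) (\<phi> (a [^] m) x)"
      by (intro mdist_triangle) auto
    also have "mdist X (\<phi> (h m n) x) (\<phi> (a [^] m) x) = mdist X x (\<phi> (b [^] n) x)"
      by (simp add: h_def isometric_action_mult[OF actX] mdist_commute[of X x])
    finally have "c * \<bar>of_int m\<bar> \<le> C * L m n + (c' + M + C)"
      using M[of n] LX[of "h m n"] c(2)[of m] by (simp add: L_def p_def)
    then show ?thesis
      using C by (simp add: field_simps)
  qed
  \<comment> \<open>Nothing is known about how \<open>a\<close> acts on \<open>Y\<close>, so this
    bound concerns powers of \<open>b\<close> alone.\<close>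
  have boundY: "e / E * \<bar>of_int n\<bar> - (e' + E) / E \<le> L 0 n" for n
  proof -
    have "e * \<bar>of_int n\<bar> \<le> E * L 0 n + (e' + E)"
      using LY[of "h 0 n"] e(2)[of n] by (simp add: L_def p_def h_def b)
    then show ?thesis
      using E by (simp add: field_simps)
  qed
  have L_nonneg: "0 \<le> L m n" for m n
    by (simp add: L_def)
  show False
    by (rule no_hyperbolic_length_on_int_pairs[of L D "c / C" _ "e / E",
          OF L_nonneg subadd four _ boundX _ boundY])
      (simp_all add: c e C E)
qed

end
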